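(* For a topological space $X$ the following assertions are equivalent: (i) $X$ has finitely many connected components. (ii) There exists an isomorphism of rings $\operatorname{Clop}(X)\simeq(\mathbb{Z}/2)^n$ for some natural number $n\ge 0$. (iii) The unit ideal of $\operatorname{Clop}(X)$ is generated by a set of primitive idempotents of $\operatorname{Clop}(X)$. (iv) $\operatorname{Clop}(X)$, as a vector space over the field $\mathbb{Z}/2$, has a basis consisting of primitive idempotents. (v) There exists an isomorphism of rings $H_0(X)\simeq\mathbb{Z}^n$ for some natural number $n\ge 0$. (vi) $H_0(X)$ is a free abelian group with a basis consisting of primitive idempotents. (vii) The unit ideal of $H_0(X)$ is generated by a set of primitive idempotents of $H_0(X)$.
   Context: $\operatorname{Clop}(X)$ is the Boolean ring of all clopen (both open and closed) subsets of $X$, with addition $A+B=(A\cup B)\setminus(A\cap B)$ and multiplication $A\cdot B=A\cap B$. $H_0(X)$ is the ring of all continuous functions $X\to\mathbb{Z}$, where $\mathbb{Z}$ is discrete, with pointwise addition and multiplication. A primitive idempotent of a commutative ring $R$ is a nonzero idempotent $e\in R$ such that if $ee'=e'$ for some nonzero idempotent $e'\in R$, then $e=e'$. For $n=0$, $(\mathbb{Z}/2)^0$ and $\mathbb{Z}^0$ denote the zero ring. Connected spaces are nonempty by convention. *)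

theory Defs
  imports
    "HOL-Analysis.Product_Topology"
    "HOL-Algebra.Algebra"
    "HOL-Number_Theory.Residues"
begin

definition clop_ring :: "'a topology \<Rightarrow> 'a set ring" where
  "clop_ring T =
     \<lparr>carrier = {A. openin T A \<and> closedin T A},
      monoid.mult = (\<lambda>A B. A \<inter> B),
      one = topspace T,
      ring.zero = {},
      add = (\<lambda>A B. (A \<union> B) - (A \<inter> B))\<rparr>"

text \<open>Functions on the space are represented by functions on the whole type that are
  \<^const>\<open>undefined\<close> outside \<^term>\<open>topspace T\<close>, so that equality in the ring is equality on the space;
  in particular the ring of an empty space has exactly one element.\<close>

definition H0_ring :: "'a topology \<Rightarrow> ('a \<Rightarrow> int) ring" where
  "H0_ring T =
     \<lparr>carrier = {f \<in> extensional (topspace T). continuous_map T (discrete_topology UNIV) f},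
      monoid.mult = (\<lambda>f g. \<lambda>x\<in>topspace T. f x * g x),
      one = (\<lambda>x\<in>topspace T. 1),
      ring.zero = (\<lambda>x\<in>topspace T. 0),
      add = (\<lambda>f g. \<lambda>x\<in>topspace T. f x + g x)\<rparr>"

definition primitive_idempotent :: "('a, 'm) ring_scheme \<Rightarrow> 'a \<Rightarrow> bool" where
  "primitive_idempotent R e \<longleftrightarrow>
     e \<in> carrier R \<and> e \<noteq> \<zero>\<^bsub>R\<^esub> \<and> e \<otimes>\<^bsub>R\<^esub> e = e \<and>
     (\<forall>e'\<in>carrier R. e' \<noteq> \<zero>\<^bsub>R\<^esub> \<and> e' \<otimes>\<^bsub>R\<^esub> e' = e' \<and> e \<otimes>\<^bsub>R\<^esub> e' = e' \<longrightarrow> e = e')"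

definition ring_power :: "('a, 'm) ring_scheme \<Rightarrow> nat \<Rightarrow> 'a list ring" where
  "ring_power R n = RDirProd_list (replicate n R)"

definition module_spans ::
    "('r, 'm) ring_scheme \<Rightarrow> ('r, 'a, 'n) module_scheme \<Rightarrow> 'a set \<Rightarrow> bool" where
  "module_spans R M B \<longleftrightarrow>
     (\<forall>x\<in>carrier M. \<exists>S a. finite S \<and> S \<subseteq> B \<and> a \<in> S \<rightarrow> carrier R \<and>
        x = finsum M (\<lambda>b. a b \<odot>\<^bsub>M\<^esub> b) S)"

definition module_independent ::
    "('r, 'm) ring_scheme \<Rightarrow> ('r, 'a, 'n) module_scheme \<Rightarrow> 'a set \<Rightarrow> bool" where
  "module_independent R M B \<longleftrightarrow>
     (\<forall>S a. finite S \<and> S \<subseteq> B \<and> a \<in> S \<rightarrow> carrier R \<and>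
        finsum M (\<lambda>b. a b \<odot>\<^bsub>M\<^esub> b) S = \<zero>\<^bsub>M\<^esub> \<longrightarrow> (\<forall>b\<in>S. a b = \<zero>\<^bsub>R\<^esub>))"

definition module_basis ::
    "('r, 'm) ring_scheme \<Rightarrow> ('r, 'a, 'n) module_scheme \<Rightarrow> 'a set \<Rightarrow> bool" where
  "module_basis R M B \<longleftrightarrow>
     B \<subseteq> carrier M \<and> module_spans R M B \<and> module_independent R M B"

text \<open>The scalars are the elements \<open>0\<close> and \<open>1\<close> of \<^term>\<open>residue_ring 2\<close>.\<close>

definition clop_vector_space :: "'a topology \<Rightarrow> (int, 'a set) module" where
  "clop_vector_space T =
     \<lparr>carrier = carrier (clop_ring T),
      monoid.mult = monoid.mult (clop_ring T),
      one = one (clop_ring T),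
      ring.zero = ring.zero (clop_ring T),
      add = add (clop_ring T),
      smult = (\<lambda>k A. if k = 0 then {} else A)\<rparr>"

text \<open>The underlying abelian group of a ring, as a module over the integers: \<^term>\<open>k\<close> acts as
  the \<^term>\<open>k\<close>-fold sum. A free abelian group with basis \<^term>\<open>B\<close> is an abelian group for which
  \<^term>\<open>B\<close> is a basis of this module.\<close>

definition int_module :: "('a, 'm) ring_scheme \<Rightarrow> (int, 'a) module" where
  "int_module R =
     \<lparr>carrier = carrier R,
      monoid.mult = monoid.mult R,
      one = one R,
      ring.zero = ring.zero R,
      add = add R,
      smult = (\<lambda>k x. add_pow R k x)\<rparr>"

lemma cring_clop_ring: "cring (clop_ring T)"
proof (rule cringI)
  show "abelian_group (clop_ring T)"
  proof (rule abelian_groupI)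
    fix A assume "A \<in> carrier (clop_ring T)"
    then show "\<exists>B\<in>carrier (clop_ring T). B \<oplus>\<^bsub>clop_ring T\<^esub> A = \<zero>\<^bsub>clop_ring T\<^esub>"
      by (intro bexI[of _ A]) (auto simp: clop_ring_def)
  qed (auto simp: clop_ring_def)
  show "Group.comm_monoid (clop_ring T)"
    by (rule comm_monoidI) (auto simp: clop_ring_def dest: openin_subset)
qed (auto simp: clop_ring_def)

lemma cring_H0_ring: "cring (H0_ring T)"
proof -
  have op: "continuous_map T (discrete_topology UNIV) (\<lambda>x. h (f x) (g x))"
    if "continuous_map T (discrete_topology UNIV) f" "continuous_map T (discrete_topology UNIV) g"
    for f g :: "'a \<Rightarrow> int" and h :: "int \<Rightarrow> int \<Rightarrow> int"
  proof -
    have "continuous_map T (prod_topology (discrete_topology UNIV) (discrete_topology UNIV))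
        (\<lambda>x. (f x, g x))"
      using that by (simp add: continuous_map_pairwise o_def)
    then have "continuous_map T (discrete_topology UNIV) (\<lambda>x. (f x, g x))"
      by (simp flip: prod_topology_discrete_topology)
    then have "continuous_map T (discrete_topology UNIV) ((\<lambda>(a, b). h a b) \<circ> (\<lambda>x. (f x, g x)))"
      by (rule continuous_map_compose) auto
    then show ?thesis
      by (simp add: o_def)
  qed
  note ops = op[of _ _ "(+)"] op[of _ _ "(*)"]
  show ?thesis
  proof (rule cringI)
    show "abelian_group (H0_ring T)"
    proof (rule abelian_groupI)
      fix f assume f: "f \<in> carrier (H0_ring T)"
      then show "\<exists>g\<in>carrier (H0_ring T). g \<oplus>\<^bsub>H0_ring T\<^esub> f = \<zero>\<^bsub>H0_ring T\<^esub>"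
        using op[of f f "\<lambda>a b. - a"]
        by (intro bexI[of _ "\<lambda>x\<in>topspace T. - f x"]) (auto simp: H0_ring_def)
    qed (auto simp: H0_ring_def extensional_def fun_eq_iff intro: ops)
    show "Group.comm_monoid (H0_ring T)"
      by (rule comm_monoidI) (auto simp: H0_ring_def extensional_def fun_eq_iff intro: ops)
  qed (auto simp: H0_ring_def fun_eq_iff algebra_simps)
qed

lemma module_clop_vector_space: "Module.module (residue_ring 2) (clop_vector_space T)"
proof -
  interpret C: cring "clop_ring T" by (rule cring_clop_ring)
  interpret F: residues 2 "residue_ring 2" by unfold_locales auto
  have "abelian_group (clop_vector_space T)"
    by (rule abelian_groupI)
      (auto simp: clop_vector_space_def C.a_ac C.add.l_inv_ex)
  moreover have "carrier (residue_ring 2) = {0, 1}"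
    by (auto simp: residue_ring_def)
  ultimately show ?thesis
    by (intro Module.moduleI F.cring)
      (auto simp: clop_vector_space_def clop_ring_def residue_ring_def simp del: F.res_carrier_eq)
qed

lemma module_int_module:
  assumes "ring R"
  shows "Module.module \<Z> (int_module R)"
proof -
  interpret ring R by fact
  have "abelian_group (int_module R)"
    by (rule abelian_groupI) (auto simp: int_module_def a_ac add.l_inv_ex)
  then show ?thesis
    by (intro Module.moduleI int_is_cring)
      (auto simp: int_module_def add.int_pow_mult add.int_pow_pow add.int_pow_distrib mult.commute)
qed

end

theory Submission
  imports
    Defs
    "HOL-Analysis.Abstract_Topological_Spaces"
begin

text \<open>The primitive idempotents of the Boolean ring of clopen sets are exactly the open connected
  components, and those of the ring of integer-valued continuous functions are their characteristic
  functions. If there are finitely many components, all of them are open, and evaluation at one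
  point of each gives the two product decompositions. Conversely, a unit
  ideal or a basis made of primitive idempotents yields a finite cover of the space by open
  components; and \<open>R\<^sup>n\<close> has only finitely many idempotents if \<open>R\<close> does, so a product decomposition
  leaves only finitely many clopen sets, in which case the intersection of all clopen sets
  containing a given point is a minimal nonempty clopen set.\<close>

section \<open>Primitive idempotents and finite covers in the ring of clopen sets\<close>

text \<open>Since the product is intersection, primitivity is minimality among the nonempty clopen
  sets. A minimal one is connected, because a clopen subset of a clopen subspace is clopen in
  \<open>T\<close>; the component around it meets it and hence lies inside it. Conversely, a
  component lies inside every clopen set that it meets. Components are always closed, so only
  openness has to be asked for.\<close>

lemma primitive_idempotent_clop_iff:
  "primitive_idempotent (clop_ring T) A \<longleftrightarrow> A \<in> connected_components_of T \<and> openin T A"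
proof
  assume "primitive_idempotent (clop_ring T) A"
  then have op: "openin T A" and cl: "closedin T A" and ne: "A \<noteq> {}"
    and min: "\<And>B. openin T B \<Longrightarrow> closedin T B \<Longrightarrow> B \<noteq> {} \<Longrightarrow> B \<subseteq> A \<Longrightarrow> A = B"
    by (auto simp: primitive_idempotent_def clop_ring_def Int_absorb1)
  have conn: "connectedin T A"
    unfolding connectedin_def connected_space_clopen_in
  proof (intro conjI allI impI)
    show "A \<subseteq> topspace T" using op by (rule openin_subset)
    fix B assume "openin (subtopology T A) B \<and> closedin (subtopology T A) B"
    then have "openin T B" "closedin T B" "B \<subseteq> A"
      using op cl openin_trans_full closedin_trans_full
      by (blast dest: openin_imp_subset)+
    then show "B = {} \<or> B = topspace (subtopology T A)"
      using min \<open>A \<subseteq> topspace T\<close> by (auto simp: topspace_subtopology Int_absorb1)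
  qed
  obtain C where C: "C \<in> connected_components_of T" "A \<subseteq> C"
    using exists_connected_component_of_superset[OF conn] ne openin_subset[OF op] by fastforce
  then have "C \<subseteq> A"
    using connectedin_clopen_cases[OF connectedin_connected_components_of cl op, of C] ne
    by (auto simp: disjnt_def)
  then show "A \<in> connected_components_of T \<and> openin T A"
    using C op by auto
next
  assume A: "A \<in> connected_components_of T \<and> openin T A"
  have "A = B" if "openin T B" "closedin T B" "B \<noteq> {}" "A \<inter> B = B" for B
    using connectedin_clopen_cases[OF connectedin_connected_components_of that(2,1), of A] A that
    by (auto simp: disjnt_def)
  then show "primitive_idempotent (clop_ring T) A"
    using A closedin_connected_components_of[of A T] nonempty_connected_components_of[of A T]
    by (auto simp: primitive_idempotent_def clop_ring_def)
qed

lemma primitive_idempotent_clop_finite: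
  assumes "finite (connected_components_of T)"
  shows "primitive_idempotent (clop_ring T) A \<longleftrightarrow> A \<in> connected_components_of T"
  using assms open_in_finite_connected_components primitive_idempotent_clop_iff by metis

text \<open>Every component has a point, this point lies in a member of \<open>F\<close>, and the
  members of \<open>F\<close> are components themselves. Overlapping components coincide, so
  \<open>F\<close> already lists all of them.\<close>

lemma finite_components_if_primitive_cover:
  assumes "finite F" "\<And>A. A \<in> F \<Longrightarrow> primitive_idempotent (clop_ring T) A" "topspace T \<subseteq> \<Union>F"
  shows "finite (connected_components_of T)"
proof (rule finite_subset[OF _ assms(1)])
  show "connected_components_of T \<subseteq> F"
  proof
    fix C assume C: "C \<in> connected_components_of T"
    then obtain x where "x \<in> C" "x \<in> topspace T"
      using nonempty_connected_components_of connected_components_of_subset by fastforce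
    then obtain A where "A \<in> F" "x \<in> A" using assms(3) by auto
    then show "C \<in> F"
      using C assms(2) \<open>x \<in> C\<close> connected_components_of_overlap[of C T A]
      by (auto simp: primitive_idempotent_clop_iff)
  qed
qed

lemma finite_components_if_finite_clop:
  assumes fin: "finite (carrier (clop_ring T))"
  shows "finite (connected_components_of T)"
proof (rule finite_components_if_primitive_cover)
  let ?P = "{A. primitive_idempotent (clop_ring T) A}"
  show "finite ?P"
    using fin by (rule rev_finite_subset) (auto simp: primitive_idempotent_def)
  show "topspace T \<subseteq> \<Union>?P"
  proof
    fix x assume x: "x \<in> topspace T"
    let ?K = "{B \<in> carrier (clop_ring T). x \<in> B}"
    let ?A = "\<Inter>?K"
    \<comment> \<open>An intersection of open sets is open when the family is finite and nonempty;
      \<open>topspace T\<close> witnesses nonemptiness.\<close>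
    have K: "finite ?K" "topspace T \<in> ?K"
      using fin finite_subset[of ?K "carrier (clop_ring T)"] x by (auto simp: clop_ring_def)
    then have op: "openin T ?A" and cl: "closedin T ?A"
      by (auto intro!: openin_Inter closedin_Inter simp: clop_ring_def)
    have "?A = B" if B: "openin T B" "closedin T B" "B \<noteq> {}" "B \<subseteq> ?A" for B
    proof -
      \<comment> \<open>Otherwise the complement of \<open>B\<close> belongs to \<open>?K\<close>,
        so \<open>?A\<close> is disjoint from \<open>B\<close> although it contains the nonempty set
        \<open>B\<close>. Once \<open>x\<close> is in \<open>B\<close>, the set \<open>B\<close>
        belongs to \<open>?K\<close> itself and contains \<open>?A\<close>.\<close>
      have "x \<in> B"
      proof (rule ccontr)
        assume "x \<notin> B"
        then have "topspace T - B \<in> ?K"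
          using B x by (auto simp: clop_ring_def)
        then show False using B(3,4) by blast
      qed
      then have "B \<in> ?K" using B by (auto simp: clop_ring_def)
      then show ?thesis using B(4) by blast
    qed
    moreover have "x \<in> ?A" by auto
    ultimately have "primitive_idempotent (clop_ring T) ?A"
      using op cl unfolding primitive_idempotent_def clop_ring_def
      by (auto simp del: Inter_iff)
    then show "x \<in> \<Union>?P" using \<open>x \<in> ?A\<close> by blast
  qed
qed auto

section \<open>Finite powers of a ring\<close>

lemma carrier_ring_power:
  "carrier (ring_power R n) = {l. length l = n \<and> set l \<subseteq> carrier R}"
  by (induction n)
    (auto simp: ring_power_def RDirProd_list_carrier length_Suc_conv image_iff)

text \<open>Prepending a head to a tail is a ring homomorphism from the binary product
  \<open>RDirProd\<close>, whose operations are componentwise by definition.\<close>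

lemma RDirProd_list_Cons_ops:
  assumes "x \<in> carrier R" "y \<in> carrier R"
    and "xs \<in> carrier (RDirProd_list Rs)" "ys \<in> carrier (RDirProd_list Rs)"
  shows "(x # xs) \<otimes>\<^bsub>RDirProd_list (R # Rs)\<^esub> (y # ys) =
           (x \<otimes>\<^bsub>R\<^esub> y) # (xs \<otimes>\<^bsub>RDirProd_list Rs\<^esub> ys)"
    and "(x # xs) \<oplus>\<^bsub>RDirProd_list (R # Rs)\<^esub> (y # ys) =
           (x \<oplus>\<^bsub>R\<^esub> y) # (xs \<oplus>\<^bsub>RDirProd_list Rs\<^esub> ys)"
proof -
  let ?P = "RDirProd R (RDirProd_list Rs)"
  have in_P: "(x, xs) \<in> carrier ?P" "(y, ys) \<in> carrier ?P"
    using assms by (auto simp: RDirProd_carrier)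
  show "(x # xs) \<otimes>\<^bsub>RDirProd_list (R # Rs)\<^esub> (y # ys) =
           (x \<otimes>\<^bsub>R\<^esub> y) # (xs \<otimes>\<^bsub>RDirProd_list Rs\<^esub> ys)"
    using ring_hom_mult[OF RDirProd_list_hom1 in_P]
    by (simp add: RDirProd_def DirProd_def monoid.defs)
  show "(x # xs) \<oplus>\<^bsub>RDirProd_list (R # Rs)\<^esub> (y # ys) =
           (x \<oplus>\<^bsub>R\<^esub> y) # (xs \<oplus>\<^bsub>RDirProd_list Rs\<^esub> ys)"
    using ring_hom_add[OF RDirProd_list_hom1 in_P]
    by (simp add: RDirProd_def DirProd_def monoid.defs)
qed

text \<open>Writing both elements as images of one common index list turns coordinatewise operations
  into pointwise operations on functions. This suits tuples of evaluations, and also a single list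
  that serves as its own index list.\<close>

lemma ring_power_map_ops:
  assumes "f ` set xs \<subseteq> carrier R" "g ` set xs \<subseteq> carrier R"
  shows "map f xs \<otimes>\<^bsub>ring_power R (length xs)\<^esub> map g xs = map (\<lambda>x. f x \<otimes>\<^bsub>R\<^esub> g x) xs"
    and "map f xs \<oplus>\<^bsub>ring_power R (length xs)\<^esub> map g xs = map (\<lambda>x. f x \<oplus>\<^bsub>R\<^esub> g x) xs"
proof -
  have "map f xs \<otimes>\<^bsub>ring_power R (length xs)\<^esub> map g xs = map (\<lambda>x. f x \<otimes>\<^bsub>R\<^esub> g x) xs \<and>
    map f xs \<oplus>\<^bsub>ring_power R (length xs)\<^esub> map g xs = map (\<lambda>x. f x \<oplus>\<^bsub>R\<^esub> g x) xs"
    using assms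
    by (induction xs)
      (auto simp: ring_power_def monoid.defs RDirProd_list_Cons_ops image_subset_iff
        carrier_ring_power[unfolded ring_power_def])
  then show "map f xs \<otimes>\<^bsub>ring_power R (length xs)\<^esub> map g xs = map (\<lambda>x. f x \<otimes>\<^bsub>R\<^esub> g x) xs"
    and "map f xs \<oplus>\<^bsub>ring_power R (length xs)\<^esub> map g xs = map (\<lambda>x. f x \<oplus>\<^bsub>R\<^esub> g x) xs"
    by auto
qed

lemma one_ring_power: "\<one>\<^bsub>ring_power R n\<^esub> = replicate n \<one>\<^bsub>R\<^esub>"
  by (induction n) (simp_all add: ring_power_def RDirProd_list_one del: RDirProd_list_nil)

text \<open>The tuple of the homomorphisms \<open>h x\<close> is a homomorphism into the power;
  \<open>sep\<close> says that it is injective and \<open>ext\<close> that it is surjective. Both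
  product decompositions apply this with the components as indices and evaluation at a chosen point
  as \<open>h\<close>. For an empty list, \<open>sep\<close> collapses \<open>R\<close> to the zero
  ring.\<close>

lemma ring_iso_ring_power:
  assumes hom: "\<And>x. x \<in> set xs \<Longrightarrow> h x \<in> ring_hom R S"
    and sep: "\<And>r r'. r \<in> carrier R \<Longrightarrow> r' \<in> carrier R \<Longrightarrow>
                (\<And>x. x \<in> set xs \<Longrightarrow> h x r = h x r') \<Longrightarrow> r = r'"
    and ext: "\<And>k. k ` set xs \<subseteq> carrier S \<Longrightarrow> \<exists>r\<in>carrier R. \<forall>x\<in>set xs. h x r = k x"
    and dist: "distinct xs"
  shows "R \<simeq> ring_power S (length xs)"
proof -
  let ?\<phi> = "\<lambda>r. map (\<lambda>x. h x r) xs"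
  have closed: "(\<lambda>x. h x r) ` set xs \<subseteq> carrier S" if "r \<in> carrier R" for r
    using that hom ring_hom_closed by fastforce
  have "?\<phi> \<in> ring_hom R (ring_power S (length xs))"
  proof (rule ring_hom_memI)
    show "?\<phi> r \<in> carrier (ring_power S (length xs))" if "r \<in> carrier R" for r
      using closed[OF that] by (simp add: carrier_ring_power)
    show "?\<phi> (r \<otimes>\<^bsub>R\<^esub> r') = ?\<phi> r \<otimes>\<^bsub>ring_power S (length xs)\<^esub> ?\<phi> r'"
      if "r \<in> carrier R" "r' \<in> carrier R" for r r'
      using that by (auto simp: ring_power_map_ops closed intro: ring_hom_mult[OF hom])
    show "?\<phi> (r \<oplus>\<^bsub>R\<^esub> r') = ?\<phi> r \<oplus>\<^bsub>ring_power S (length xs)\<^esub> ?\<phi> r'"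
      if "r \<in> carrier R" "r' \<in> carrier R" for r r'
      using that by (auto simp: ring_power_map_ops closed intro: ring_hom_add[OF hom])
    show "?\<phi> \<one>\<^bsub>R\<^esub> = \<one>\<^bsub>ring_power S (length xs)\<^esub>"
      using hom by (auto simp: one_ring_power ring_hom_one intro!: replicate_eqI)
  qed
  moreover have "bij_betw ?\<phi> (carrier R) (carrier (ring_power S (length xs)))"
    unfolding bij_betw_def
  proof
    show "inj_on ?\<phi> (carrier R)"
      by (rule inj_onI, rule sep) auto
    show "?\<phi> ` carrier R = carrier (ring_power S (length xs))"
    proof
      show "?\<phi> ` carrier R \<subseteq> carrier (ring_power S (length xs))"
        using closed by (auto simp: carrier_ring_power image_subset_iff)
      show "carrier (ring_power S (length xs)) \<subseteq> ?\<phi> ` carrier R"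
      proof
        fix l assume "l \<in> carrier (ring_power S (length xs))"
        then have l: "length l = length xs" "set l \<subseteq> carrier S"
          by (auto simp: carrier_ring_power)
        \<comment> \<open>As the indices are distinct, the tuple \<open>l\<close> can be read as a
          function on them: \<open>k\<close> looks up the entry at the position of its
          argument.\<close>
        define k where "k = the \<circ> map_of (zip xs l)"
        have k: "map k xs = l"
          using dist l(1) by (auto simp: list_eq_iff_nth_eq k_def map_of_zip_nth)
        with l(2) have "k ` set xs \<subseteq> carrier S" by (metis set_map)
        then obtain r where "r \<in> carrier R" "\<forall>x\<in>set xs. h x r = k x" using ext by blast
        moreover from this k have "?\<phi> r = l" by (auto simp: k[symmetric])
        ultimately show "l \<in> ?\<phi> ` carrier R" by blast
      qed
    qed
  qed
  ultimately show ?thesis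
    unfolding is_ring_iso_def ring_iso_def by blast
qed

text \<open>Multiplication in the power is coordinatewise, so an idempotent of \<open>R\<close> goes
  to a list of \<open>n\<close> idempotents of \<open>S\<close>. There are finitely many such lists,
  and the isomorphism is injective.\<close>

lemma finite_idempotents_if_ring_power:
  assumes iso: "R \<simeq> ring_power S n"
    and fin: "finite {s \<in> carrier S. s \<otimes>\<^bsub>S\<^esub> s = s}"
  shows "finite {r \<in> carrier R. r \<otimes>\<^bsub>R\<^esub> r = r}"
proof -
  obtain h where h: "h \<in> ring_hom R (ring_power S n)" "inj_on h (carrier R)"
    using iso by (auto simp: is_ring_iso_def ring_iso_def bij_betw_def)
  have "h ` {r \<in> carrier R. r \<otimes>\<^bsub>R\<^esub> r = r} \<subseteq>
      {l. set l \<subseteq> {s \<in> carrier S. s \<otimes>\<^bsub>S\<^esub> s = s} \<and> length l = n}"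
  proof clarsimp
    fix r assume r: "r \<in> carrier R" "r \<otimes>\<^bsub>R\<^esub> r = r"
    have l: "length (h r) = n" "set (h r) \<subseteq> carrier S"
      using ring_hom_closed[OF h(1) r(1)] by (auto simp: carrier_ring_power)
    have "h r \<otimes>\<^bsub>ring_power S n\<^esub> h r = h r"
      using ring_hom_mult[OF h(1) r(1) r(1)] r(2) by simp
    \<comment> \<open>The list \<open>h r\<close> is its own index list here, with the identity as
      both coordinate functions.\<close>
    then have "map (\<lambda>s. s \<otimes>\<^bsub>S\<^esub> s) (h r) = map (\<lambda>s. s) (h r)"
      using ring_power_map_ops(1)[of "\<lambda>s. s" "h r" S "\<lambda>s. s"] l by simp
    then have "\<forall>s\<in>set (h r). s \<otimes>\<^bsub>S\<^esub> s = s"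
      unfolding map_eq_conv .
    then show "set (h r) \<subseteq> {s \<in> carrier S. s \<otimes>\<^bsub>S\<^esub> s = s} \<and> length (h r) = n"
      using l by auto
  qed
  then have "finite (h ` {r \<in> carrier R. r \<otimes>\<^bsub>R\<^esub> r = r})"
    by (rule finite_subset) (rule finite_lists_length_eq[OF fin])
  then show ?thesis
    by (rule finite_imageD) (rule inj_on_subset[OF h(2)], auto)
qed

section \<open>Supports of elements of a generated ideal\<close>

text \<open>The elements whose support is covered by the supports of finitely many generators form
  an ideal containing \<open>S\<close>, hence contain the ideal generated by \<open>S\<close>. The
  abstract \<open>supp\<close> serves two cases: a clopen set is its own support, and a function is
  supported where it does not vanish. Applied to the unit, it yields a finite cover of the
  space.\<close>

lemma genideal_supp:
  fixes supp :: "'b \<Rightarrow> 'c set"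
  assumes "ring R" and S: "S \<subseteq> carrier R"
    and supp_zero: "supp \<zero>\<^bsub>R\<^esub> = {}"
    and supp_add: "\<And>a b. a \<in> carrier R \<Longrightarrow> b \<in> carrier R \<Longrightarrow> supp (a \<oplus>\<^bsub>R\<^esub> b) \<subseteq> supp a \<union> supp b"
    and supp_mult: "\<And>a b. a \<in> carrier R \<Longrightarrow> b \<in> carrier R \<Longrightarrow> supp (a \<otimes>\<^bsub>R\<^esub> b) \<subseteq> supp a \<inter> supp b"
    and a: "a \<in> Idl\<^bsub>R\<^esub> S"
  obtains F where "finite F" "F \<subseteq> S" "supp a \<subseteq> \<Union>(supp ` F)"
proof -
  interpret ring R by fact
  define I where "I = {a \<in> carrier R. \<exists>F. finite F \<and> F \<subseteq> S \<and> supp a \<subseteq> \<Union>(supp ` F)}"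
  have I_I: "b \<in> I" if "b \<in> carrier R" "finite F" "F \<subseteq> S" "supp b \<subseteq> \<Union>(supp ` F)" for b F
    using that unfolding I_def by blast
  have I_E: "\<exists>F. finite F \<and> F \<subseteq> S \<and> supp b \<subseteq> \<Union>(supp ` F)" "b \<in> carrier R" if "b \<in> I" for b
    using that unfolding I_def by blast+
  have sub: "b \<in> I" if "a \<in> I" "b \<in> carrier R" "supp b \<subseteq> supp a" for a b
    using I_E[OF that(1)] that(2,3) I_I[of b] by (meson order_trans)
  have "ideal I R"
  proof (rule idealI)
    show "subgroup I (add_monoid R)"
    proof (rule add.subgroupI)
      show "I \<noteq> {}" using I_I[of "\<zero>\<^bsub>R\<^esub>" "{}"] supp_zero by auto
      show "I \<subseteq> carrier R" unfolding I_def by blast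
    next
      fix a b assume ab: "a \<in> I" "b \<in> I"
      obtain F G where FG: "finite F" "F \<subseteq> S" "supp a \<subseteq> \<Union>(supp ` F)"
        "finite G" "G \<subseteq> S" "supp b \<subseteq> \<Union>(supp ` G)"
        using I_E(1)[OF ab(1)] I_E(1)[OF ab(2)] by blast
      have "supp (a \<oplus>\<^bsub>R\<^esub> b) \<subseteq> \<Union>(supp ` (F \<union> G))"
        using supp_add[of a b] I_E(2) ab FG(3,6) by fastforce
      then show "a \<oplus>\<^bsub>R\<^esub> b \<in> I"
        using I_I[of "a \<oplus>\<^bsub>R\<^esub> b" "F \<union> G"] FG I_E(2) ab by simp
    next
      fix a assume a: "a \<in> I"
      \<comment> \<open>Negatives are controlled through multiplication: the negative of
        \<open>a\<close> is the product of minus one and \<open>a\<close>.\<close>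
      then have "supp (\<ominus>\<^bsub>R\<^esub> a) \<subseteq> supp a"
        using supp_mult[of "\<ominus>\<^bsub>R\<^esub> \<one>\<^bsub>R\<^esub>" a] I_E(2)[OF a] by (simp add: l_minus)
      then show "\<ominus>\<^bsub>R\<^esub> a \<in> I"
        using sub[OF a] I_E(2)[OF a] by simp
    qed
    fix a b assume a: "a \<in> I" and b: "b \<in> carrier R"
    show "b \<otimes>\<^bsub>R\<^esub> a \<in> I" "a \<otimes>\<^bsub>R\<^esub> b \<in> I"
      using supp_mult[OF b I_E(2)[OF a]] supp_mult[OF I_E(2)[OF a] b] I_E(2)[OF a] b sub[OF a] by simp_all
  qed fact
  moreover have "S \<subseteq> I"
  proof
    fix s assume "s \<in> S"
    then show "s \<in> I" using S I_I[of s "{s}"] by auto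
  qed
  ultimately have "a \<in> I"
    using a genideal_minimal by blast
  from I_E(1)[OF this] show ?thesis
    by (elim exE conjE) (rule that)
qed

section \<open>The characterizations through the ring of clopen sets\<close>

text \<open>The sum of disjoint sets is their union. Hence the ideal contains every finite union of
  components, in particular the union of all of them, which is the unit.\<close>

lemma Idl_components_clop:
  assumes fin: "finite (connected_components_of T)"
  shows "Idl\<^bsub>clop_ring T\<^esub> (connected_components_of T) = carrier (clop_ring T)"
proof -
  interpret cring "clop_ring T" by (rule cring_clop_ring)
  let ?I = "Idl\<^bsub>clop_ring T\<^esub> (connected_components_of T)"
  have sub: "connected_components_of T \<subseteq> carrier (clop_ring T)"
    using primitive_idempotent_clop_finite[OF fin] by (auto simp: primitive_idempotent_def)
  interpret I: ideal ?I "clop_ring T" by (rule genideal_ideal[OF sub])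
  have "\<Union>F \<in> ?I" if "finite F" "F \<subseteq> connected_components_of T" for F
    using that
  proof (induction F)
    case empty
    show ?case using I.zero_closed by (simp add: clop_ring_def)
  next
    case (insert C F)
    have "C \<inter> \<Union>F = {}"
      using insert connected_components_of_overlap[of C T] by auto
    then have "\<Union>(insert C F) = C \<oplus>\<^bsub>clop_ring T\<^esub> \<Union>F"
      by (auto simp: clop_ring_def)
    then show ?case
      using insert genideal_self[OF sub] I.a_closed by auto
  qed
  from this[OF fin] have "\<one>\<^bsub>clop_ring T\<^esub> \<in> ?I"
    by (simp add: Union_connected_components_of) (simp add: clop_ring_def)
  then show ?thesis by (rule I.one_imp_carrier)
qed

lemma finite_components_iff_clop_unit_ideal:
  "finite (connected_components_of T) \<longleftrightarrow>
     (\<exists>S. (\<forall>e\<in>S. primitive_idempotent (clop_ring T) e) \<and>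
          Idl\<^bsub>clop_ring T\<^esub> S = carrier (clop_ring T))"
proof
  assume "finite (connected_components_of T)"
  then show "\<exists>S. (\<forall>e\<in>S. primitive_idempotent (clop_ring T) e) \<and>
      Idl\<^bsub>clop_ring T\<^esub> S = carrier (clop_ring T)"
    using Idl_components_clop primitive_idempotent_clop_finite by blast
next
  assume "\<exists>S. (\<forall>e\<in>S. primitive_idempotent (clop_ring T) e) \<and>
      Idl\<^bsub>clop_ring T\<^esub> S = carrier (clop_ring T)"
  then obtain S where S: "\<And>e. e \<in> S \<Longrightarrow> primitive_idempotent (clop_ring T) e"
    and "topspace T \<in> Idl\<^bsub>clop_ring T\<^esub> S"
    by (auto simp: clop_ring_def)
  \<comment> \<open>Each clopen set is its own support, so membership of the unit in the ideal
    yields finitely many generators covering the space.\<close>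
  then obtain F where "finite F" "F \<subseteq> S" "topspace T \<subseteq> \<Union>((\<lambda>A. A) ` F)"
    by (rule_tac genideal_supp[of "clop_ring T" S "\<lambda>A. A" "topspace T"])
      (auto simp: primitive_idempotent_def cring.axioms(1)[OF cring_clop_ring], auto simp: clop_ring_def)
  then show "finite (connected_components_of T)"
    using finite_components_if_primitive_cover[of F T] S by auto
qed

lemma finite_components_iff_clop_power:
  "finite (connected_components_of T) \<longleftrightarrow> (\<exists>n. clop_ring T \<simeq> ring_power (residue_ring 2) n)"
proof
  assume fin: "finite (connected_components_of T)"
  obtain cs where cs: "set cs = connected_components_of T" "distinct cs"
    using finite_distinct_list[OF fin] by blast
  have clopen: "openin T C" "closedin T C" if "C \<in> connected_components_of T" for C
    using that fin open_in_finite_connected_components closedin_connected_components_of by metis+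
  \<comment> \<open>A representative point of each component; the isomorphism tests whether a clopen
    set contains it.\<close>
  define p where "p C = (SOME x. x \<in> C)" for C :: "'a set"
  have p: "p C \<in> C" if "C \<in> connected_components_of T" for C
    using nonempty_connected_components_of[OF that] unfolding p_def by (simp add: some_in_eq)
  have "clop_ring T \<simeq> ring_power (residue_ring 2) (length cs)"
  proof (rule ring_iso_ring_power[where h = "\<lambda>C A. of_bool (p C \<in> A)"])
    fix C assume C: "C \<in> set cs"
    \<comment> \<open>This makes the test send the unit \<open>topspace T\<close> to 1.\<close>
    then have "p C \<in> topspace T"
      using p connected_components_of_subset cs(1) by blast
    then show "(\<lambda>A. of_bool (p C \<in> A)) \<in> ring_hom (clop_ring T) (residue_ring 2)"
      by (intro ring_hom_memI) (auto simp: clop_ring_def residue_ring_def)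
  next
    fix A B
    assume AB: "A \<in> carrier (clop_ring T)" "B \<in> carrier (clop_ring T)"
      and eq: "\<And>C. C \<in> set cs \<Longrightarrow> (of_bool (p C \<in> A) :: int) = of_bool (p C \<in> B)"
    \<comment> \<open>A clopen set contains a component entirely or misses it, so the representative
      decides for all points of the component.\<close>
    have iff: "x \<in> A \<longleftrightarrow> p C \<in> A" if "x \<in> C" "C \<in> set cs" "A \<in> carrier (clop_ring T)" for x C A
      using connectedin_clopen_cases[OF connectedin_connected_components_of, of C T A] p[of C] that cs
      by (auto simp: clop_ring_def disjnt_iff)
    have "A \<subseteq> \<Union>(set cs)" "B \<subseteq> \<Union>(set cs)"
      using AB by (auto simp: cs(1) Union_connected_components_of clop_ring_def dest: openin_subset)
    moreover have "x \<in> A \<longleftrightarrow> x \<in> B" if "x \<in> C" "C \<in> set cs" for x C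
      using iff that AB eq[of C] by auto
    ultimately show "A = B" by blast
  next
    fix k :: "'a set \<Rightarrow> int" assume k: "k ` set cs \<subseteq> carrier (residue_ring 2)"
    \<comment> \<open>The components with prescribed value 1. There are finitely many, so their
      union is closed as well as open.\<close>
    let ?A = "\<Union>{C \<in> set cs. k C = 1}"
    have "?A \<in> carrier (clop_ring T)"
      using clopen by (auto simp: clop_ring_def cs(1)[symmetric] intro!: openin_Union closedin_Union)
    moreover have "of_bool (p C \<in> ?A) = k C" if "C \<in> set cs" for C
    proof -
      have "k C = 0 \<or> k C = 1"
        using k that by (auto simp: residue_ring_def)
      moreover have "p C \<in> ?A \<longleftrightarrow> k C = 1"
        using that p[of C] connected_components_of_overlap[of C T] cs(1) by blast
      ultimately show ?thesis by auto
    qed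
    ultimately show "\<exists>A\<in>carrier (clop_ring T). \<forall>C\<in>set cs. of_bool (p C \<in> A) = k C" by blast
  qed (use cs in auto)
  then show "\<exists>n. clop_ring T \<simeq> ring_power (residue_ring 2) n" ..
next
  assume "\<exists>n. clop_ring T \<simeq> ring_power (residue_ring 2) n"
  then obtain n where n: "clop_ring T \<simeq> ring_power (residue_ring 2) n" ..
  \<comment> \<open>Every element of a Boolean ring is idempotent, so finitely many idempotents
    means a finite ring.\<close>
  have "finite {A \<in> carrier (clop_ring T). A \<otimes>\<^bsub>clop_ring T\<^esub> A = A}"
    using n by (rule finite_idempotents_if_ring_power)
      (rule finite_subset[of _ "{0..1}"], auto simp: residue_ring_def)
  then have "finite (carrier (clop_ring T))"
    by (simp add: clop_ring_def)
  then show "finite (connected_components_of T)"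
    by (rule finite_components_if_finite_clop)
qed

lemma clop_vector_space_simps:
  "carrier (clop_vector_space T) = {A. openin T A \<and> closedin T A}"
  "\<zero>\<^bsub>clop_vector_space T\<^esub> = {}"
  "A \<oplus>\<^bsub>clop_vector_space T\<^esub> B = (A \<union> B) - (A \<inter> B)"
  "k \<odot>\<^bsub>clop_vector_space T\<^esub> A = (if k = 0 then {} else A)"
  by (simp_all add: clop_vector_space_def clop_ring_def)

text \<open>Adding a set by symmetric difference flips the membership of exactly its points, so
  membership in the sum is a parity. Indices are counted rather than sets, since \<open>g\<close>
  may repeat values.\<close>

lemma clop_vector_space_finsum:
  assumes "finite S" "g \<in> S \<rightarrow> carrier (clop_vector_space T)"
  shows "x \<in> finsum (clop_vector_space T) g S \<longleftrightarrow> odd (card {b \<in> S. x \<in> g b})"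
proof -
  interpret V: abelian_group "clop_vector_space T"
    using module_clop_vector_space by (rule Module.module.axioms)
  show ?thesis
    using assms
  proof (induction S)
    case empty
    show ?case by (simp add: V.finsum_empty clop_vector_space_simps)
  next
    case (insert a S)
    have "finsum (clop_vector_space T) g (insert a S) =
        g a \<oplus>\<^bsub>clop_vector_space T\<^esub> finsum (clop_vector_space T) g S"
      using insert by (intro V.finsum_insert) auto
    also have "x \<in> \<dots> \<longleftrightarrow> (x \<in> g a) \<noteq> (x \<in> finsum (clop_vector_space T) g S)"
      by (auto simp: clop_vector_space_simps)
    also have "x \<in> finsum (clop_vector_space T) g S \<longleftrightarrow> odd (card {b \<in> S. x \<in> g b})"
      using insert by (intro insert.IH) auto
    also have "((x \<in> g a) \<noteq> odd (card {b \<in> S. x \<in> g b})) \<longleftrightarrow>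
        odd (card {b \<in> insert a S. x \<in> g b})"
    proof (cases "x \<in> g a")
      case True
      then have "{b \<in> insert a S. x \<in> g b} = insert a {b \<in> S. x \<in> g b}" by auto
      with True insert.hyps show ?thesis by simp
    next
      case False
      then have "{b \<in> insert a S. x \<in> g b} = {b \<in> S. x \<in> g b}" by auto
      with False show ?thesis by simp
    qed
    finally show ?case .
  qed
qed

text \<open>Finitely many components are clopen and partition the space, so the coefficient of a
  component can be read off at any of its points; this gives spanning and independence. Conversely,
  the expansion of \<open>topspace T\<close> involves finitely many primitive idempotents, and these
  must cover every point.\<close>

lemma finite_components_iff_clop_basis:
  "finite (connected_components_of T) \<longleftrightarrow>
     (\<exists>B. (\<forall>e\<in>B. primitive_idempotent (clop_ring T) e) \<and>
          module_basis (residue_ring 2) (clop_vector_space T) B)"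
proof
  let ?V = "clop_vector_space T" and ?B = "connected_components_of T"
  assume fin: "finite ?B"
  have carr: "C \<in> carrier ?V" if "C \<in> ?B" for C
    using that open_in_finite_connected_components[OF fin] closedin_connected_components_of
    by (auto simp: clop_vector_space_simps)
  have smult: "k \<odot>\<^bsub>?V\<^esub> A = (if k = 0 then {} else A)" for k A
    by (simp add: clop_vector_space_simps)
  have closed: "(\<lambda>b. a b \<odot>\<^bsub>?V\<^esub> b) \<in> S \<rightarrow> carrier ?V" if "S \<subseteq> ?B" for S a
    using carr that by (auto simp: clop_vector_space_simps)
  \<comment> \<open>A point of \<open>C\<close> lies in no other component, so at most one summand
    contains it and the parity reduces to the coefficient of \<open>C\<close>.\<close>
  have mem: "x \<in> finsum ?V (\<lambda>b. a b \<odot>\<^bsub>?V\<^esub> b) S \<longleftrightarrow> C \<in> S \<and> a C \<noteq> 0"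
    if "S \<subseteq> ?B" "C \<in> ?B" "x \<in> C" for S a x C
  proof -
    have "{b \<in> S. x \<in> a b \<odot>\<^bsub>?V\<^esub> b} = (if C \<in> S \<and> a C \<noteq> 0 then {C} else {})"
      using that connected_components_of_overlap[of C T] by (auto simp: smult split: if_splits)
    then show ?thesis
      using clop_vector_space_finsum[OF finite_subset[OF \<open>S \<subseteq> ?B\<close> fin] closed[OF \<open>S \<subseteq> ?B\<close>], of x a]
      by simp
  qed
  have "module_spans (residue_ring 2) ?V ?B"
    unfolding module_spans_def
  proof
    fix A assume A: "A \<in> carrier ?V"
    \<comment> \<open>A clopen set is the sum, with all coefficients 1, of the components inside
      it.\<close>
    let ?S = "{C \<in> ?B. C \<subseteq> A}"
    have in_top: "A \<subseteq> topspace T" "finsum ?V (\<lambda>b. 1 \<odot>\<^bsub>?V\<^esub> b) ?S \<subseteq> topspace T"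
    proof -
      interpret V: Module.module "residue_ring 2" ?V
        by (rule module_clop_vector_space)
      have "finsum ?V (\<lambda>b. 1 \<odot>\<^bsub>?V\<^esub> b) ?S \<in> carrier ?V"
        by (rule V.finsum_closed, rule closed) auto
      with A show "A \<subseteq> topspace T" "finsum ?V (\<lambda>b. 1 \<odot>\<^bsub>?V\<^esub> b) ?S \<subseteq> topspace T"
        by (auto simp: clop_vector_space_simps dest: openin_subset)
    qed
    have "x \<in> A \<longleftrightarrow> x \<in> finsum ?V (\<lambda>b. 1 \<odot>\<^bsub>?V\<^esub> b) ?S" if "x \<in> topspace T" for x
    proof -
      obtain C where C: "C \<in> ?B" "x \<in> C"
        using \<open>x \<in> topspace T\<close> by (metis Union_iff Union_connected_components_of)
      then have "x \<in> A \<longleftrightarrow> C \<subseteq> A"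
        using connectedin_clopen_cases[OF connectedin_connected_components_of, of C T A] A
        by (auto simp: clop_vector_space_simps disjnt_iff)
      then show ?thesis using mem[of ?S C x "\<lambda>_. 1"] C by auto
    qed
    then have "A = finsum ?V (\<lambda>b. 1 \<odot>\<^bsub>?V\<^esub> b) ?S"
      using in_top by blast
    then show "\<exists>S a. finite S \<and> S \<subseteq> ?B \<and> a \<in> S \<rightarrow> carrier (residue_ring 2) \<and>
        A = finsum ?V (\<lambda>b. a b \<odot>\<^bsub>?V\<^esub> b) S"
      using fin by (intro exI[of _ ?S] exI[of _ "\<lambda>_. 1"]) (auto simp: residue_ring_def)
  qed
  moreover have "module_independent (residue_ring 2) ?V ?B"
    unfolding module_independent_def
  proof (intro allI impI ballI)
    fix S a C
    assume S: "finite S \<and> S \<subseteq> ?B \<and> a \<in> S \<rightarrow> carrier (residue_ring 2) \<and>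
      finsum ?V (\<lambda>b. a b \<odot>\<^bsub>?V\<^esub> b) S = \<zero>\<^bsub>?V\<^esub>" and C: "C \<in> S"
    then obtain x where "x \<in> C"
      using nonempty_connected_components_of by blast
    moreover have "x \<notin> finsum ?V (\<lambda>b. a b \<odot>\<^bsub>?V\<^esub> b) S"
      using S by (simp add: clop_vector_space_simps)
    ultimately show "a C = \<zero>\<^bsub>residue_ring 2\<^esub>"
      using mem[of S C x a] S C by (auto simp: residue_ring_def)
  qed
  ultimately show "\<exists>B. (\<forall>e\<in>B. primitive_idempotent (clop_ring T) e) \<and>
      module_basis (residue_ring 2) ?V B"
    using primitive_idempotent_clop_finite[OF fin] carr
    by (auto simp: module_basis_def intro!: exI[of _ ?B])
next
  let ?V = "clop_vector_space T"
  assume "\<exists>B. (\<forall>e\<in>B. primitive_idempotent (clop_ring T) e) \<and>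
      module_basis (residue_ring 2) ?V B"
  then obtain B where B: "\<And>e. e \<in> B \<Longrightarrow> primitive_idempotent (clop_ring T) e"
    and span: "module_spans (residue_ring 2) ?V B"
    by (auto simp: module_basis_def)
  have "topspace T \<in> carrier ?V"
    by (simp add: clop_vector_space_simps)
  from bspec[OF span[unfolded module_spans_def] this]
  obtain S a where S: "finite S" "S \<subseteq> B"
    and eq: "topspace T = finsum ?V (\<lambda>b. a b \<odot>\<^bsub>?V\<^esub> b) S"
    by (elim exE conjE) (rule that)
  have "(\<lambda>b. a b \<odot>\<^bsub>?V\<^esub> b) \<in> S \<rightarrow> carrier ?V"
    using S(2) B[unfolded primitive_idempotent_clop_iff] closedin_connected_components_of[of _ T]
    by (auto simp: clop_vector_space_simps subset_iff)
  note mem = clop_vector_space_finsum[OF S(1) this]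
  have "x \<in> \<Union>S" if "x \<in> topspace T" for x
  proof -
    \<comment> \<open>An odd number of summands is at least one, and a summand containing
      \<open>x\<close> has a nonzero coefficient, so it is the set \<open>b\<close> itself.\<close>
    have "odd (card {b \<in> S. x \<in> a b \<odot>\<^bsub>?V\<^esub> b})"
      using that mem eq by simp
    then have "{b \<in> S. x \<in> a b \<odot>\<^bsub>?V\<^esub> b} \<noteq> {}"
      by (metis card.empty even_zero)
    then show ?thesis
      by (auto simp: clop_vector_space_simps split: if_splits)
  qed
  then show "finite (connected_components_of T)"
    using finite_components_if_primitive_cover[of S T] S B by blast
qed


section \<open>Idempotents of the ring of integer-valued continuous functions\<close>

text \<open>The restriction to \<open>topspace T\<close> makes the function extensional, as
  membership in \<open>H0_ring T\<close> demands.\<close>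

definition char_fn :: "'a topology \<Rightarrow> 'a set \<Rightarrow> 'a \<Rightarrow> int" where
  "char_fn T A = (\<lambda>x\<in>topspace T. of_bool (x \<in> A))"

lemma char_fn_apply [simp]: "x \<in> topspace T \<Longrightarrow> char_fn T A x = of_bool (x \<in> A)"
  by (simp add: char_fn_def)

lemma char_fn_in_carrier:
  assumes "openin T A" "closedin T A"
  shows "char_fn T A \<in> carrier (H0_ring T)"
proof -
  have "openin T {x \<in> topspace T. char_fn T A x \<in> U}" for U
  proof -
    \<comment> \<open>The preimage of \<open>U\<close> depends only on which of 0 and 1 lie in
      \<open>U\<close>; it is put together from \<open>A\<close> and its complement.\<close>
    have "openin T ((if 1 \<in> U then A else {}) \<union> (if 0 \<in> U then topspace T - A else {}))"
      using assms by auto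
    also have "(if 1 \<in> U then A else {}) \<union> (if 0 \<in> U then topspace T - A else {}) =
        {x \<in> topspace T. char_fn T A x \<in> U}"
      using openin_subset[OF assms(1)] by (auto simp: of_bool_def split: if_splits)
    finally show ?thesis .
  qed
  then show ?thesis
    by (simp add: H0_ring_def continuous_map_def) (simp add: char_fn_def)
qed

lemma char_fn_eq_iff:
  assumes "A \<subseteq> topspace T" "B \<subseteq> topspace T"
  shows "char_fn T A = char_fn T B \<longleftrightarrow> A = B"
proof
  assume eq: "char_fn T A = char_fn T B"
  have "x \<in> A \<longleftrightarrow> x \<in> B" if "x \<in> topspace T" for x
    using fun_cong[OF eq, of x] that by (simp add: of_bool_def split: if_splits)
  then show "A = B" using assms by blast
qed simp

lemma zero_H0: "\<zero>\<^bsub>H0_ring T\<^esub> = char_fn T {}"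
  by (simp add: H0_ring_def char_fn_def)

lemma one_H0: "\<one>\<^bsub>H0_ring T\<^esub> = char_fn T (topspace T)"
  by (auto simp: H0_ring_def char_fn_def)

lemma H0_apply:
  assumes "x \<in> topspace T"
  shows "(f \<otimes>\<^bsub>H0_ring T\<^esub> g) x = f x * g x" "(f \<oplus>\<^bsub>H0_ring T\<^esub> g) x = f x + g x"
  using assms by (simp_all add: H0_ring_def)

lemma H0_eqI:
  assumes "f \<in> carrier (H0_ring T)" "g \<in> carrier (H0_ring T)"
    and "\<And>x. x \<in> topspace T \<Longrightarrow> f x = g x"
  shows "f = g"
  using assms by (auto simp: H0_ring_def intro: extensionalityI)

lemma mult_char_fn: "char_fn T A \<otimes>\<^bsub>H0_ring T\<^esub> char_fn T B = char_fn T (A \<inter> B)"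
  by (auto simp: H0_ring_def char_fn_def)

lemma add_char_fn:
  assumes "A \<inter> B = {}"
  shows "char_fn T A \<oplus>\<^bsub>H0_ring T\<^esub> char_fn T B = char_fn T (A \<union> B)"
  using assms by (auto simp: H0_ring_def char_fn_def fun_eq_iff)

lemma clopen_level_set:
  assumes "f \<in> carrier (H0_ring T)"
  shows "openin T {x \<in> topspace T. f x \<in> U}" "closedin T {x \<in> topspace T. f x \<in> U}"
proof -
  have f: "continuous_map T (discrete_topology UNIV) f"
    using assms by (simp add: H0_ring_def)
  show "openin T {x \<in> topspace T. f x \<in> U}" "closedin T {x \<in> topspace T. f x \<in> U}"
    using openin_continuous_map_preimage[OF f, of U] closedin_continuous_map_preimage[OF f, of U]
    by simp_all
qed

text \<open>The level set of the value \<open>f x\<close> is clopen and meets \<open>C\<close> in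
  \<open>x\<close>, so it contains the connected set \<open>C\<close>.\<close>

lemma H0_constant_on_component:
  assumes f: "f \<in> carrier (H0_ring T)"
    and C: "C \<in> connected_components_of T" "x \<in> C" "y \<in> C"
  shows "f x = f y"
proof -
  have "C \<subseteq> {z \<in> topspace T. f z \<in> {f x}} \<or> disjnt C {z \<in> topspace T. f z \<in> {f x}}"
    using clopen_level_set[OF f] connectedin_connected_components_of[OF C(1)]
    by (intro connectedin_clopen_cases)
  moreover have "x \<in> topspace T"
    using C connected_components_of_subset by blast
  ultimately show ?thesis
    using C(2,3) by (auto simp: disjnt_iff)
qed

text \<open>The only idempotent integers are 0 and 1, so an idempotent function is determined by its
  level set at 1, which is clopen.\<close>

lemma idempotent_H0:
  assumes f: "f \<in> carrier (H0_ring T)" "f \<otimes>\<^bsub>H0_ring T\<^esub> f = f"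
  obtains A where "openin T A" "closedin T A" "f = char_fn T A"
proof (rule that)
  let ?A = "{x \<in> topspace T. f x \<in> {1}}"
  show clopen: "openin T ?A" "closedin T ?A"
    by (rule clopen_level_set[OF f(1)])+
  show "f = char_fn T ?A"
  proof (rule H0_eqI)
    fix x assume x: "x \<in> topspace T"
    then have "f x * f x = f x"
      using H0_apply(1)[OF x, of f f] f(2) by simp
    then show "f x = char_fn T ?A x" using x by auto
  qed (rule f(1) char_fn_in_carrier clopen)+
qed

text \<open>Passing to characteristic functions is a bijection from clopen sets to idempotents that
  turns intersections into products and the empty set into zero; primitivity is expressed in these
  terms alone and carries over.\<close>

lemma primitive_idempotent_H0_iff:
  "primitive_idempotent (H0_ring T) f \<longleftrightarrow>
     (\<exists>A. primitive_idempotent (clop_ring T) A \<and> f = char_fn T A)"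
proof
  assume f: "primitive_idempotent (H0_ring T) f"
  then obtain A where A: "openin T A" "closedin T A" "f = char_fn T A"
    by (auto simp: primitive_idempotent_def elim: idempotent_H0)
  have "A = B" if B: "openin T B" "closedin T B" "B \<noteq> {}" "A \<inter> B = B" for B
  proof -
    have "f = char_fn T B"
      using f char_fn_in_carrier[OF B(1,2)] B(3,4) openin_subset[OF B(1)]
      by (auto simp: primitive_idempotent_def A(3) mult_char_fn zero_H0 char_fn_eq_iff)
    then show ?thesis
      using A(3) openin_subset[OF A(1)] openin_subset[OF B(1)] by (simp add: char_fn_eq_iff)
  qed
  moreover have "A \<noteq> {}"
    using f by (auto simp: primitive_idempotent_def zero_H0 A(3))
  ultimately have "primitive_idempotent (clop_ring T) A"
    using A(1,2) by (auto simp: primitive_idempotent_def clop_ring_def)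
  with A(3) show "\<exists>A. primitive_idempotent (clop_ring T) A \<and> f = char_fn T A" by blast
next
  assume "\<exists>A. primitive_idempotent (clop_ring T) A \<and> f = char_fn T A"
  then obtain A where A: "openin T A" "closedin T A" "A \<noteq> {}" and f: "f = char_fn T A"
    and min: "\<And>B. openin T B \<Longrightarrow> closedin T B \<Longrightarrow> B \<noteq> {} \<Longrightarrow> A \<inter> B = B \<Longrightarrow> A = B"
    by (auto simp: primitive_idempotent_def clop_ring_def)
  have "f = g" if g: "g \<in> carrier (H0_ring T)" "g \<noteq> \<zero>\<^bsub>H0_ring T\<^esub>"
    "g \<otimes>\<^bsub>H0_ring T\<^esub> g = g" "f \<otimes>\<^bsub>H0_ring T\<^esub> g = g" for g
  proof -
    obtain B where B: "openin T B" "closedin T B" "g = char_fn T B"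
      using g(1,3) by (rule idempotent_H0)
    have "A \<inter> B \<subseteq> topspace T"
      using openin_subset[OF A(1)] by blast
    then have "A \<inter> B = B"
      using g(4) openin_subset[OF B(1)] by (simp add: f B(3) mult_char_fn char_fn_eq_iff)
    moreover have "B \<noteq> {}" using g(2) by (auto simp: B(3) zero_H0)
    ultimately show ?thesis using min[OF B(1,2)] f B(3) by simp
  qed
  then show "primitive_idempotent (H0_ring T) f"
    using A char_fn_in_carrier[OF A(1,2)] openin_subset[OF A(1)]
    by (auto simp: primitive_idempotent_def f mult_char_fn zero_H0 char_fn_eq_iff)
qed

text \<open>Each member of \<open>F\<close> is the characteristic function of a primitive clopen set
  and is nonzero exactly on it, so these sets form a finite cover.\<close>

lemma finite_components_if_H0_cover:
  assumes F: "finite F" "\<And>f. f \<in> F \<Longrightarrow> primitive_idempotent (H0_ring T) f"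
    and cover: "\<And>x. x \<in> topspace T \<Longrightarrow> \<exists>f\<in>F. f x \<noteq> 0"
  shows "finite (connected_components_of T)"
proof -
  obtain supp where supp: "\<And>f. f \<in> F \<Longrightarrow> primitive_idempotent (clop_ring T) (supp f)"
    "\<And>f. f \<in> F \<Longrightarrow> f = char_fn T (supp f)"
    using F(2) unfolding primitive_idempotent_H0_iff by metis
  have "x \<in> \<Union>(supp ` F)" if "x \<in> topspace T" for x
  proof -
    obtain f where f: "f \<in> F" "f x \<noteq> 0" using cover \<open>x \<in> topspace T\<close> by metis
    then have "char_fn T (supp f) x \<noteq> 0"
      using supp(2) by metis
    then have "x \<in> supp f" using \<open>x \<in> topspace T\<close> by simp
    then show ?thesis using f(1) by blast
  qed
  then have "topspace T \<subseteq> \<Union>(supp ` F)" by blast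
  then show ?thesis
    using finite_components_if_primitive_cover[of "supp ` F" T] F(1) supp(1) by blast
qed

section \<open>The characterizations through the ring of continuous functions\<close>

text \<open>Characteristic functions of disjoint sets add up to that of the union, so the ideal
  reaches the constant function 1 by adding one component at a time.\<close>

lemma Idl_components_H0:
  assumes fin: "finite (connected_components_of T)"
  shows "Idl\<^bsub>H0_ring T\<^esub> (char_fn T ` connected_components_of T) = carrier (H0_ring T)"
proof -
  interpret cring "H0_ring T" by (rule cring_H0_ring)
  let ?I = "Idl\<^bsub>H0_ring T\<^esub> (char_fn T ` connected_components_of T)"
  have sub: "char_fn T ` connected_components_of T \<subseteq> carrier (H0_ring T)"
    using open_in_finite_connected_components[OF fin] closedin_connected_components_of
    by (auto intro!: char_fn_in_carrier)
  interpret I: ideal ?I "H0_ring T" by (rule genideal_ideal[OF sub])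
  have "char_fn T (\<Union>F) \<in> ?I" if "finite F" "F \<subseteq> connected_components_of T" for F
    using that
  proof (induction F)
    case empty
    show ?case using I.zero_closed by (simp add: zero_H0)
  next
    case (insert C F)
    have "C \<inter> \<Union>F = {}"
      using insert connected_components_of_overlap[of C T] by auto
    then have "char_fn T (\<Union>(insert C F)) = char_fn T C \<oplus>\<^bsub>H0_ring T\<^esub> char_fn T (\<Union>F)"
      by (simp add: add_char_fn)
    then show ?case
      using insert genideal_self[OF sub] I.a_closed by auto
  qed
  from this[OF fin] have "\<one>\<^bsub>H0_ring T\<^esub> \<in> ?I"
    by (simp add: Union_connected_components_of one_H0)
  then show ?thesis by (rule I.one_imp_carrier)
qed

lemma finite_components_iff_H0_unit_ideal:
  "finite (connected_components_of T) \<longleftrightarrow>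
     (\<exists>S. (\<forall>e\<in>S. primitive_idempotent (H0_ring T) e) \<and>
          Idl\<^bsub>H0_ring T\<^esub> S = carrier (H0_ring T))"
proof
  assume fin: "finite (connected_components_of T)"
  have "\<forall>e\<in>char_fn T ` connected_components_of T. primitive_idempotent (H0_ring T) e"
    using primitive_idempotent_clop_finite[OF fin] unfolding primitive_idempotent_H0_iff by blast
  then show "\<exists>S. (\<forall>e\<in>S. primitive_idempotent (H0_ring T) e) \<and>
      Idl\<^bsub>H0_ring T\<^esub> S = carrier (H0_ring T)"
    using Idl_components_H0[OF fin] by blast
next
  assume "\<exists>S. (\<forall>e\<in>S. primitive_idempotent (H0_ring T) e) \<and>
      Idl\<^bsub>H0_ring T\<^esub> S = carrier (H0_ring T)"
  then obtain S where S: "\<And>e. e \<in> S \<Longrightarrow> primitive_idempotent (H0_ring T) e"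
    and Idl: "Idl\<^bsub>H0_ring T\<^esub> S = carrier (H0_ring T)" by metis
  \<comment> \<open>Only points of the space count, because elsewhere the functions take the value
    \<open>undefined\<close>.\<close>
  define supp where "supp f = {x \<in> topspace T. f x \<noteq> 0}" for f :: "'a \<Rightarrow> int"
  have ring: "ring (H0_ring T)"
    using cring_H0_ring by (rule cring.axioms)
  obtain F where F: "finite F" "F \<subseteq> S" "supp \<one>\<^bsub>H0_ring T\<^esub> \<subseteq> \<Union>(supp ` F)"
  proof (rule genideal_supp[of "H0_ring T" S supp "\<one>\<^bsub>H0_ring T\<^esub>"])
    show "S \<subseteq> carrier (H0_ring T)" using S by (auto simp: primitive_idempotent_def)
    show "\<one>\<^bsub>H0_ring T\<^esub> \<in> Idl\<^bsub>H0_ring T\<^esub> S"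
      unfolding Idl by (rule ring.ring_simprules(6)[OF ring])
  qed (use ring in \<open>auto simp: supp_def zero_H0 H0_apply\<close>)
  have "\<exists>f\<in>F. f x \<noteq> 0" if "x \<in> topspace T" for x
  proof -
    have "x \<in> supp \<one>\<^bsub>H0_ring T\<^esub>" using that by (simp add: supp_def one_H0)
    then show ?thesis using F(3) by (auto simp: supp_def)
  qed
  then show "finite (connected_components_of T)"
    using F S by (intro finite_components_if_H0_cover[of F T]) auto
qed

lemma finite_components_iff_H0_power:
  "finite (connected_components_of T) \<longleftrightarrow> (\<exists>n. H0_ring T \<simeq> ring_power \<Z> n)"
proof
  assume fin: "finite (connected_components_of T)"
  obtain cs where cs: "set cs = connected_components_of T" "distinct cs"
    using finite_distinct_list[OF fin] by blast
  define p where "p C = (SOME x. x \<in> C)" for C :: "'a set"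
  have p: "p C \<in> C" if "C \<in> connected_components_of T" for C
    using nonempty_connected_components_of[OF that] unfolding p_def by (simp add: some_in_eq)
  have p_top: "p C \<in> topspace T" if "C \<in> connected_components_of T" for C
    using p[OF that] connected_components_of_subset[OF that] by blast
  have "H0_ring T \<simeq> ring_power \<Z> (length cs)"
  proof (rule ring_iso_ring_power[where h = "\<lambda>C f. f (p C)"])
    fix C assume "C \<in> set cs"
    then show "(\<lambda>f. f (p C)) \<in> ring_hom (H0_ring T) \<Z>"
      using p_top[of C] by (intro ring_hom_memI) (auto simp: cs(1) H0_apply one_H0)
  next
    fix f g
    assume fg: "f \<in> carrier (H0_ring T)" "g \<in> carrier (H0_ring T)"
      and eq: "\<And>C. C \<in> set cs \<Longrightarrow> f (p C) = g (p C)"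
    show "f = g"
    proof (rule H0_eqI[OF fg])
      fix x assume "x \<in> topspace T"
      then obtain C where C: "C \<in> connected_components_of T" "x \<in> C"
        by (metis Union_iff Union_connected_components_of)
      then show "f x = g x"
        using H0_constant_on_component[OF fg(1) C p[OF C(1)]]
          H0_constant_on_component[OF fg(2) C p[OF C(1)]] eq[of C] cs(1) by simp
    qed
  next
    fix k :: "'a set \<Rightarrow> int"
    \<comment> \<open>The function with the prescribed value \<open>k C\<close> throughout each
      component \<open>C\<close>. Its preimages are unions of components, and these are open because
      there are finitely many components.\<close>
    define f where "f = (\<lambda>x\<in>topspace T. k (connected_component_of_set T x))"
    have f_eq: "f x = k C" if "C \<in> connected_components_of T" "x \<in> C" for x C
    proof -
      have x: "x \<in> topspace T"
        using that connected_components_of_subset by blast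
      then have "connected_component_of_set T x \<in> connected_components_of T"
        by (simp add: connected_component_in_connected_components_of)
      moreover have "x \<in> connected_component_of_set T x"
        using x by (simp add: connected_component_of_refl)
      ultimately have "connected_component_of_set T x = C"
        using that connected_components_of_overlap[of C T "connected_component_of_set T x"] by blast
      then show ?thesis using x by (simp add: f_def)
    qed
    have "openin T {x \<in> topspace T. f x \<in> U}" for U
    proof -
      have "openin T (\<Union>{C \<in> connected_components_of T. k C \<in> U})"
        using open_in_finite_connected_components[OF fin] by (intro openin_Union) simp
      also have "\<Union>{C \<in> connected_components_of T. k C \<in> U} = {x \<in> topspace T. f x \<in> U}"
      proof (intro equalityI subsetI)
        fix x assume "x \<in> \<Union>{C \<in> connected_components_of T. k C \<in> U}"
        then obtain C where C: "C \<in> connected_components_of T" "x \<in> C" "k C \<in> U" by blast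
        then show "x \<in> {x \<in> topspace T. f x \<in> U}"
          using f_eq[OF C(1,2)] connected_components_of_subset[OF C(1)] by auto
      next
        fix x assume x: "x \<in> {x \<in> topspace T. f x \<in> U}"
        then obtain C where C: "C \<in> connected_components_of T" "x \<in> C"
          using Union_connected_components_of[of T] by (metis (no_types, lifting) Union_iff mem_Collect_eq)
        then show "x \<in> \<Union>{C \<in> connected_components_of T. k C \<in> U}"
          using f_eq[OF C] x by auto
      qed
      finally show ?thesis .
    qed
    then have "f \<in> carrier (H0_ring T)"
      by (simp add: H0_ring_def continuous_map_def) (simp add: f_def)
    moreover have "\<forall>C\<in>set cs. f (p C) = k C"
      using f_eq p cs(1) by simp
    ultimately show "\<exists>f\<in>carrier (H0_ring T). \<forall>C\<in>set cs. f (p C) = k C" by (intro bexI[of _ f])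
  qed (rule cs(2))
  then show "\<exists>n. H0_ring T \<simeq> ring_power \<Z> n" ..
next
  assume "\<exists>n. H0_ring T \<simeq> ring_power \<Z> n"
  then obtain n where n: "H0_ring T \<simeq> ring_power \<Z> n" ..
  have "z \<in> {0, 1}" if "z * z = z" for z :: int
    using that by simp
  then have "{z \<in> carrier \<Z>. z \<otimes>\<^bsub>\<Z>\<^esub> z = z} \<subseteq> {0, 1}" by auto
  then have "finite {z \<in> carrier \<Z>. z \<otimes>\<^bsub>\<Z>\<^esub> z = z}"
    by (rule finite_subset) simp
  with n have fin: "finite {f \<in> carrier (H0_ring T). f \<otimes>\<^bsub>H0_ring T\<^esub> f = f}"
    by (rule finite_idempotents_if_ring_power)
  \<comment> \<open>Clopen sets embed into the idempotents by their characteristic functions, so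
    finiteness passes from the idempotents to the clopen sets.\<close>
  have "char_fn T ` carrier (clop_ring T) \<subseteq> {f \<in> carrier (H0_ring T). f \<otimes>\<^bsub>H0_ring T\<^esub> f = f}"
    by (auto simp: clop_ring_def char_fn_in_carrier mult_char_fn)
  then have "finite (char_fn T ` carrier (clop_ring T))"
    using fin by (rule finite_subset)
  moreover have "inj_on (char_fn T) (carrier (clop_ring T))"
    by (rule inj_onI) (auto simp: clop_ring_def char_fn_eq_iff openin_subset)
  ultimately have "finite (carrier (clop_ring T))"
    by (rule finite_imageD)
  then show "finite (connected_components_of T)"
    by (rule finite_components_if_finite_clop)
qed

text \<open>The scalar action is repeated addition, continued to negative integers by additive
  inverses, and evaluation at \<open>x\<close> respects both.\<close>

lemma int_module_H0_smult:
  assumes f: "f \<in> carrier (H0_ring T)" and x: "x \<in> topspace T"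
  shows "(k \<odot>\<^bsub>int_module (H0_ring T)\<^esub> f) x = k * f x"
proof -
  interpret cring "H0_ring T" by (rule cring_H0_ring)
  have nat: "(add_pow (H0_ring T) n f) x = int n * f x" for n :: nat
    by (induction n) (use x f in \<open>simp_all add: H0_apply zero_H0 algebra_simps\<close>)
  \<comment> \<open>The inverse is given only abstractly; its value comes from evaluating its sum
    with \<open>g\<close>, which is zero.\<close>
  have minus: "(\<ominus>\<^bsub>H0_ring T\<^esub> g) x = - g x" if "g \<in> carrier (H0_ring T)" for g
  proof -
    have "(\<ominus>\<^bsub>H0_ring T\<^esub> g \<oplus>\<^bsub>H0_ring T\<^esub> g) x = 0"
      using that x by (simp add: l_neg zero_H0)
    then show ?thesis using x by (simp add: H0_apply)
  qed
  have smult: "k \<odot>\<^bsub>int_module (H0_ring T)\<^esub> f = add_pow (H0_ring T) k f"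
    by (simp add: int_module_def)
  show ?thesis
  proof (cases "k \<ge> 0")
    case True
    then show ?thesis
      using nat[of "nat k"] by (simp add: smult add_pow_int_ge)
  next
    case False
    then show ?thesis
      using nat[of "nat (- k)"] minus[of "add_pow (H0_ring T) (nat (- k)) f"] f
      by (simp add: smult add_pow_int_lt)
  qed
qed

lemma int_module_simps:
  "carrier (int_module R) = carrier R" "\<zero>\<^bsub>int_module R\<^esub> = \<zero>\<^bsub>R\<^esub>"
  "f \<oplus>\<^bsub>int_module R\<^esub> g = f \<oplus>\<^bsub>R\<^esub> g"
  by (simp_all add: int_module_def)

lemma int_module_H0_finsum:
  assumes "finite S" "g \<in> S \<rightarrow> carrier (H0_ring T)" and x: "x \<in> topspace T"
  shows "finsum (int_module (H0_ring T)) g S x = (\<Sum>b\<in>S. g b x)"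
proof -
  have "ring (H0_ring T)"
    using cring_H0_ring by (rule cring.axioms)
  then interpret V: abelian_group "int_module (H0_ring T)"
    using module_int_module Module.module.axioms by metis
  show ?thesis
    using assms(1,2)
  proof (induction S)
    case empty
    show ?case using x by (simp add: V.finsum_empty int_module_simps zero_H0)
  next
    case (insert a S)
    have "finsum (int_module (H0_ring T)) g (insert a S) =
        g a \<oplus>\<^bsub>int_module (H0_ring T)\<^esub> finsum (int_module (H0_ring T)) g S"
      using insert by (intro V.finsum_insert) (auto simp: int_module_simps)
    moreover have "g \<in> S \<rightarrow> carrier (H0_ring T)" using insert.prems by auto
    ultimately show ?case
      using insert.hyps insert.IH x by (simp add: int_module_simps H0_apply)
  qed
qed

text \<open>Evaluation at a point of a component isolates one coefficient. This gives independence,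
  and it shows that \<open>f\<close> expands with its constant values on the components as
  coefficients. Conversely, the expansion of the constant 1 uses finitely many primitive idempotents
  without a common zero.\<close>

lemma finite_components_iff_H0_basis:
  "finite (connected_components_of T) \<longleftrightarrow>
     (\<exists>B. (\<forall>e\<in>B. primitive_idempotent (H0_ring T) e) \<and>
          module_basis \<Z> (int_module (H0_ring T)) B)"
proof
  let ?V = "int_module (H0_ring T)" and ?B = "char_fn T ` connected_components_of T"
  assume fin: "finite (connected_components_of T)"
  have ring: "ring (H0_ring T)"
    using cring_H0_ring by (rule cring.axioms)
  interpret V: Module.module \<Z> ?V
    using ring by (rule module_int_module)
  have prim: "\<forall>e\<in>?B. primitive_idempotent (H0_ring T) e"
    using primitive_idempotent_clop_finite[OF fin] unfolding primitive_idempotent_H0_iff by blast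
  have carr: "b \<in> carrier ?V" if "b \<in> ?B" for b
    using prim that by (auto simp: primitive_idempotent_def int_module_simps)
  have closed: "(\<lambda>b. a b \<odot>\<^bsub>?V\<^esub> b) \<in> S \<rightarrow> carrier ?V" if "S \<subseteq> ?B" for S a
    using carr that by (auto intro!: V.smult_closed)
  have val: "finsum ?V (\<lambda>b. a b \<odot>\<^bsub>?V\<^esub> b) S x = (if char_fn T C \<in> S then a (char_fn T C) else 0)"
    if SB: "S \<subseteq> ?B" and C: "C \<in> connected_components_of T" "x \<in> C" for S a x C
  proof -
    have x: "x \<in> topspace T"
      using C connected_components_of_subset by blast
    have finS: "finite S" using SB fin finite_subset by blast
    have "finsum ?V (\<lambda>b. a b \<odot>\<^bsub>?V\<^esub> b) S x = (\<Sum>b\<in>S. (a b \<odot>\<^bsub>?V\<^esub> b) x)"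
      using closed[OF SB] by (intro int_module_H0_finsum[OF finS _ x]) (simp add: int_module_simps)
    \<comment> \<open>Since \<open>x\<close> lies in \<open>C\<close> alone and different components
      have different characteristic functions, at most the term of \<open>char_fn T C\<close>
      survives.\<close>
    also have "\<dots> = (\<Sum>b\<in>S. if b = char_fn T C then a b else 0)"
    proof (rule sum.cong)
      fix b assume "b \<in> S"
      then obtain D where D: "D \<in> connected_components_of T" "b = char_fn T D"
        using SB by blast
      have "x \<in> D \<longleftrightarrow> D = C"
        using D(1) C connected_components_of_overlap[of C T D] by blast
      moreover have "b = char_fn T C \<longleftrightarrow> D = C"
        using D C(1) by (simp add: char_fn_eq_iff connected_components_of_subset)
      moreover have "(a b \<odot>\<^bsub>?V\<^esub> b) x = a b * b x"
        using carr[of b] \<open>b \<in> S\<close> SB x by (intro int_module_H0_smult) (auto simp: int_module_simps)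
      ultimately show "(a b \<odot>\<^bsub>?V\<^esub> b) x = (if b = char_fn T C then a b else 0)"
        using x D(2) by simp
    qed simp
    also have "\<dots> = (if char_fn T C \<in> S then a (char_fn T C) else 0)"
      using finS by simp
    finally show ?thesis .
  qed
  have "module_spans \<Z> ?V ?B"
    unfolding module_spans_def
  proof
    fix f assume f: "f \<in> carrier ?V"
    \<comment> \<open>Coefficients are indexed by the basis functions, so the component has to be
      recovered from \<open>b\<close>: a point with \<open>b x = 1\<close> lies in it, and by
      constancy of \<open>f\<close> there, any choice gives the same value.\<close>
    define a where "a b = f (SOME x. x \<in> topspace T \<and> b x = 1)" for b :: "'a \<Rightarrow> int"
    have "f = finsum ?V (\<lambda>b. a b \<odot>\<^bsub>?V\<^esub> b) ?B"
    proof (rule H0_eqI)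
      show "f \<in> carrier (H0_ring T)" using f by (simp add: int_module_simps)
      show "finsum ?V (\<lambda>b. a b \<odot>\<^bsub>?V\<^esub> b) ?B \<in> carrier (H0_ring T)"
        using V.finsum_closed[OF closed[of ?B a]] by (simp add: int_module_simps)
      fix x assume "x \<in> topspace T"
      then obtain C where C: "C \<in> connected_components_of T" "x \<in> C"
        by (metis Union_iff Union_connected_components_of)
      define y where "y = (SOME y. y \<in> topspace T \<and> char_fn T C y = 1)"
      have "y \<in> topspace T \<and> char_fn T C y = 1"
        unfolding y_def by (rule someI[of _ x]) (use \<open>x \<in> topspace T\<close> C in simp)
      then have "y \<in> C" by (auto split: if_splits)
      then have "f x = a (char_fn T C)"
        using H0_constant_on_component[OF _ C, of f y] f by (simp add: a_def y_def int_module_simps)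
      then show "f x = finsum ?V (\<lambda>b. a b \<odot>\<^bsub>?V\<^esub> b) ?B x"
        using val[of ?B C x a] C by simp
    qed
    then show "\<exists>S a. finite S \<and> S \<subseteq> ?B \<and> a \<in> S \<rightarrow> carrier \<Z> \<and>
        f = finsum ?V (\<lambda>b. a b \<odot>\<^bsub>?V\<^esub> b) S"
      using fin by (intro exI[of _ ?B] exI[of _ a]) simp
  qed
  moreover have "module_independent \<Z> ?V ?B"
    unfolding module_independent_def
  proof (intro allI impI ballI)
    fix S a b
    assume S: "finite S \<and> S \<subseteq> ?B \<and> a \<in> S \<rightarrow> carrier \<Z> \<and>
      finsum ?V (\<lambda>b. a b \<odot>\<^bsub>?V\<^esub> b) S = \<zero>\<^bsub>?V\<^esub>" and b: "b \<in> S"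
    then obtain C where C: "C \<in> connected_components_of T" "b = char_fn T C" by blast
    then obtain x where x: "x \<in> C"
      using nonempty_connected_components_of by blast
    then have "x \<in> topspace T"
      using C(1) connected_components_of_subset by blast
    then have "finsum ?V (\<lambda>b. a b \<odot>\<^bsub>?V\<^esub> b) S x = 0"
      using S by (simp add: int_module_simps zero_H0)
    then show "a b = \<zero>\<^bsub>\<Z>\<^esub>"
      using val[of S C x a] S C x b by simp
  qed
  ultimately have "module_basis \<Z> ?V ?B"
    using carr by (auto simp: module_basis_def)
  then show "\<exists>B. (\<forall>e\<in>B. primitive_idempotent (H0_ring T) e) \<and> module_basis \<Z> ?V B"
    using prim by blast
next
  let ?V = "int_module (H0_ring T)"
  assume "\<exists>B. (\<forall>e\<in>B. primitive_idempotent (H0_ring T) e) \<and> module_basis \<Z> ?V B"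
  then obtain B where B: "\<And>e. e \<in> B \<Longrightarrow> primitive_idempotent (H0_ring T) e"
    and span: "module_spans \<Z> ?V B"
    by (auto simp: module_basis_def)
  have ring: "ring (H0_ring T)"
    using cring_H0_ring by (rule cring.axioms)
  interpret V: Module.module \<Z> ?V
    using ring by (rule module_int_module)
  have "\<one>\<^bsub>H0_ring T\<^esub> \<in> carrier ?V"
    using ring.ring_simprules(6)[OF ring] by (simp add: int_module_simps)
  from bspec[OF span[unfolded module_spans_def] this]
  obtain S a where S: "finite S" "S \<subseteq> B"
    and eq: "\<one>\<^bsub>H0_ring T\<^esub> = finsum ?V (\<lambda>b. a b \<odot>\<^bsub>?V\<^esub> b) S"
    by (elim exE conjE) (rule that)
  have carr: "b \<in> carrier (H0_ring T)" if "b \<in> S" for b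
    using B S(2) that by (auto simp: primitive_idempotent_def)
  then have closed: "(\<lambda>b. a b \<odot>\<^bsub>?V\<^esub> b) \<in> S \<rightarrow> carrier (H0_ring T)"
    using V.smult_closed by (auto simp: int_module_simps)
  \<comment> \<open>If all members of \<open>S\<close> vanished at \<open>x\<close>, so would their
    combination, which is the constant 1.\<close>
  have "\<exists>b\<in>S. b x \<noteq> 0" if x: "x \<in> topspace T" for x
  proof (rule ccontr)
    assume "\<not> (\<exists>b\<in>S. b x \<noteq> 0)"
    then have "finsum ?V (\<lambda>b. a b \<odot>\<^bsub>?V\<^esub> b) S x = 0"
      using carr x by (simp add: int_module_H0_finsum[OF S(1) closed x] int_module_H0_smult sum.neutral)
    then show False
      using x by (simp add: eq[symmetric] one_H0)
  qed
  then show "finite (connected_components_of T)"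
    using S B by (intro finite_components_if_H0_cover[of S T]) auto
qed

theorem theorem5p2:
  fixes T :: "'a topology"
  shows
    "(finite (connected_components_of T) \<longleftrightarrow>
        (\<exists>n::nat. clop_ring T \<simeq> ring_power (residue_ring 2) n)) \<and>
     (finite (connected_components_of T) \<longleftrightarrow>
        (\<exists>S. (\<forall>e\<in>S. primitive_idempotent (clop_ring T) e) \<and>
             Idl\<^bsub>clop_ring T\<^esub> S = carrier (clop_ring T))) \<and>
     (finite (connected_components_of T) \<longleftrightarrow>
        (\<exists>B. (\<forall>e\<in>B. primitive_idempotent (clop_ring T) e) \<and>
             module_basis (residue_ring 2) (clop_vector_space T) B)) \<and>
     (finite (connected_components_of T) \<longleftrightarrow>
        (\<exists>n::nat. H0_ring T \<simeq> ring_power \<Z> n)) \<and>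
     (finite (connected_components_of T) \<longleftrightarrow>
        (\<exists>B. (\<forall>e\<in>B. primitive_idempotent (H0_ring T) e) \<and>
             module_basis \<Z> (int_module (H0_ring T)) B)) \<and>
     (finite (connected_components_of T) \<longleftrightarrow>
        (\<exists>S. (\<forall>e\<in>S. primitive_idempotent (H0_ring T) e) \<and>
             Idl\<^bsub>H0_ring T\<^esub> S = carrier (H0_ring T)))"
  by (intro conjI finite_components_iff_clop_power finite_components_iff_clop_unit_ideal
      finite_components_iff_clop_basis finite_components_iff_H0_power
      finite_components_iff_H0_basis finite_components_iff_H0_unit_ideal)

end
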